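(* Let $k$ be a field, $R$ a semiprime $k$-algebra, $G$ a torsion group and $\alpha: G\times G\to k^*$ a normalized $2$-cocycle such that $[G:Z_\alpha(G)]<\infty$. Suppose that either $\operatorname{char} R=0$ or, for every characteristic $p$ of $R$, $p\nmid o(g)$ for all $g\in G$. Then every $R$-derivation of the twisted group ring $R^\alpha G$ is inner.
   Context: Algebras are associative and unital, not necessarily commutative; $k^*$ is the multiplicative group of $k$, and its elements are regarded as central units of $R$. The order of $g\in G$ is denoted $o(g)$. A prime $p$ is a characteristic of $R$ if $pr=0$ for some nonzero $r\in R$ (since $R$ is an algebra over the field $k$, the only possible one is $p=\operatorname{char} k$). A $2$-cocycle is a map $\alpha:G\times G\to k^*$ with $\alpha(x,y)\alpha(xy,z)=\alpha(y,z)\alpha(x,yz)$ for all $x,y,z\in G$; it is normalized if $\alpha(1,g)=\alpha(g,1)=1$ for all $g\in G$. The twisted group ring $R^\alpha G$ is the free left $R$-module with basis $\{\overline{g}: g\in G\}$ and product $(a\overline{g})(b\overline{h})=ab\,\alpha(g,h)\,\overline{gh}$ ($a,b\in R$, $g,h\in G$), extended by additivity; $R$ is identified with $R\,\overline{1}$. The $\alpha$-center of $G$ is $Z_\alpha(G)=\{a\in Z(G): \alpha(a,x)=\alpha(x,a)\ \text{for all } x\in G\}$, a subgroup of the center $Z(G)$. A derivation of a ring $S$ is an additive map $d:S\to S$ with $d(ab)=d(a)b+a\,d(b)$ for all $a,b\in S$. A derivation $d$ of $R^\alpha G$ is an $R$-derivation if $d(R)=\{0\}$. It is inner if there is $a\in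 R^\alpha G$ with $d(x)=ax-xa$ for all $x\in R^\alpha G$. *)

theory Defs
  imports "HOL-Algebra.Algebra"
begin

text \<open>
  The library locale \<^locale>\<open>algebra\<close> covers commutative algebras only. Compatibility of
  the scalars with both factors says that they act through central elements.
\<close>

locale assoc_algebra = module K R + A: ring R
  for K :: "('k, 'a) ring_scheme" and R :: "('k, 'r, 'b) module_scheme" +
  assumes smult_mult_left:
      "\<lbrakk>c \<in> carrier K; x \<in> carrier R; y \<in> carrier R\<rbrakk>
        \<Longrightarrow> (c \<odot>\<^bsub>R\<^esub> x) \<otimes>\<^bsub>R\<^esub> y = c \<odot>\<^bsub>R\<^esub> (x \<otimes>\<^bsub>R\<^esub> y)"
    and smult_mult_right:
      "\<lbrakk>c \<in> carrier K; x \<in> carrier R; y \<in> carrier R\<rbrakk>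
        \<Longrightarrow> x \<otimes>\<^bsub>R\<^esub> (c \<odot>\<^bsub>R\<^esub> y) = c \<odot>\<^bsub>R\<^esub> (x \<otimes>\<^bsub>R\<^esub> y)"

definition semiprime_ring :: "('r, 'b) ring_scheme \<Rightarrow> bool" where
  "semiprime_ring R \<longleftrightarrow>
     ring R \<and> (\<forall>I. ideal I R \<longrightarrow> ideal_prod R I I = {\<zero>\<^bsub>R\<^esub>} \<longrightarrow> I = {\<zero>\<^bsub>R\<^esub>})"

definition ring_char :: "('r, 'b) ring_scheme \<Rightarrow> nat" where
  "ring_char R =
     (if \<exists>n::nat. n > 0 \<and> [n] \<cdot>\<^bsub>R\<^esub> \<one>\<^bsub>R\<^esub> = \<zero>\<^bsub>R\<^esub>
      then LEAST n::nat. n > 0 \<and> [n] \<cdot>\<^bsub>R\<^esub> \<one>\<^bsub>R\<^esub> = \<zero>\<^bsub>R\<^esub> else 0)"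

definition is_characteristic :: "nat \<Rightarrow> ('r, 'b) ring_scheme \<Rightarrow> bool" where
  "is_characteristic p R \<longleftrightarrow>
     Factorial_Ring.prime p \<and> (\<exists>r\<in>carrier R. r \<noteq> \<zero>\<^bsub>R\<^esub> \<and> [p] \<cdot>\<^bsub>R\<^esub> r = \<zero>\<^bsub>R\<^esub>)"

definition torsion_group :: "('g, 'c) monoid_scheme \<Rightarrow> bool" where
  "torsion_group G \<longleftrightarrow>
     group G \<and> (\<forall>g\<in>carrier G. \<exists>n::nat. n > 0 \<and> g [^]\<^bsub>G\<^esub> n = \<one>\<^bsub>G\<^esub>)"

definition group_center :: "('g, 'c) monoid_scheme \<Rightarrow> 'g set" where
  "group_center G = {a \<in> carrier G. \<forall>x\<in>carrier G. a \<otimes>\<^bsub>G\<^esub> x = x \<otimes>\<^bsub>G\<^esub> a}"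

definition two_cocycle ::
    "('k, 'a) ring_scheme \<Rightarrow> ('g, 'c) monoid_scheme \<Rightarrow> ('g \<Rightarrow> 'g \<Rightarrow> 'k) \<Rightarrow> bool" where
  "two_cocycle K G \<alpha> \<longleftrightarrow>
     (\<forall>x\<in>carrier G. \<forall>y\<in>carrier G. \<alpha> x y \<in> Units K) \<and>
     (\<forall>x\<in>carrier G. \<forall>y\<in>carrier G. \<forall>z\<in>carrier G.
        \<alpha> x y \<otimes>\<^bsub>K\<^esub> \<alpha> (x \<otimes>\<^bsub>G\<^esub> y) z = \<alpha> y z \<otimes>\<^bsub>K\<^esub> \<alpha> x (y \<otimes>\<^bsub>G\<^esub> z))"

definition normalized_two_cocycle ::
    "('k, 'a) ring_scheme \<Rightarrow> ('g, 'c) monoid_scheme \<Rightarrow> ('g \<Rightarrow> 'g \<Rightarrow> 'k) \<Rightarrow> bool" where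
  "normalized_two_cocycle K G \<alpha> \<longleftrightarrow>
     two_cocycle K G \<alpha> \<and>
     (\<forall>g\<in>carrier G. \<alpha> \<one>\<^bsub>G\<^esub> g = \<one>\<^bsub>K\<^esub> \<and> \<alpha> g \<one>\<^bsub>G\<^esub> = \<one>\<^bsub>K\<^esub>)"

definition alpha_center :: "('g, 'c) monoid_scheme \<Rightarrow> ('g \<Rightarrow> 'g \<Rightarrow> 'k) \<Rightarrow> 'g set" where
  "alpha_center G \<alpha> = {a \<in> group_center G. \<forall>x\<in>carrier G. \<alpha> a x = \<alpha> x a}"

text \<open>
  An element of the twisted group ring is its coefficient function, of finite support and set
  to zero outside \<^term>\<open>carrier G\<close>. The coefficient of a product at \<open>x\<close> collects the terms
  \<open>u g \<cdot> v h \<cdot> \<alpha>(g, h)\<close> with \<open>g h = x\<close>.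
\<close>

definition tgr_supp ::
    "('r, 'b) ring_scheme \<Rightarrow> ('g, 'c) monoid_scheme \<Rightarrow> ('g \<Rightarrow> 'r) \<Rightarrow> 'g set" where
  "tgr_supp R G u = {g \<in> carrier G. u g \<noteq> \<zero>\<^bsub>R\<^esub>}"

definition twisted_group_ring ::
    "('k, 'r, 'b) module_scheme \<Rightarrow> ('g, 'c) monoid_scheme \<Rightarrow> ('g \<Rightarrow> 'g \<Rightarrow> 'k) \<Rightarrow> ('g \<Rightarrow> 'r) ring" where
  "twisted_group_ring R G \<alpha> =
     \<lparr> carrier = {u. (\<forall>g\<in>carrier G. u g \<in> carrier R) \<and> (\<forall>g. g \<notin> carrier G \<longrightarrow> u g = \<zero>\<^bsub>R\<^esub>)
                     \<and> finite (tgr_supp R G u)},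
       monoid.mult = (\<lambda>u v x. finsum R (\<lambda>(g, h). \<alpha> g h \<odot>\<^bsub>R\<^esub> (u g \<otimes>\<^bsub>R\<^esub> v h))
                 {(g, h). g \<in> tgr_supp R G u \<and> h \<in> tgr_supp R G v \<and> g \<otimes>\<^bsub>G\<^esub> h = x}),
       one = (\<lambda>g. if g = \<one>\<^bsub>G\<^esub> then \<one>\<^bsub>R\<^esub> else \<zero>\<^bsub>R\<^esub>),
       ring.zero = (\<lambda>g. \<zero>\<^bsub>R\<^esub>),
       ring.add = (\<lambda>u v g. u g \<oplus>\<^bsub>R\<^esub> v g) \<rparr>"

definition tgr_monom :: "('r, 'b) ring_scheme \<Rightarrow> 'r \<Rightarrow> 'g \<Rightarrow> ('g \<Rightarrow> 'r)" where
  "tgr_monom R a g = (\<lambda>x. if x = g then a else \<zero>\<^bsub>R\<^esub>)"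

text \<open>The image of the coefficient ring under \<open>r \<mapsto> r 1\<close>.\<close>

definition tgr_coeffs ::
    "('r, 'b) ring_scheme \<Rightarrow> ('g, 'c) monoid_scheme \<Rightarrow> ('g \<Rightarrow> 'r) set" where
  "tgr_coeffs R G = (\<lambda>r. tgr_monom R r \<one>\<^bsub>G\<^esub>) ` carrier R"

definition derivation :: "('s, 'c) ring_scheme \<Rightarrow> ('s \<Rightarrow> 's) \<Rightarrow> bool" where
  "derivation S d \<longleftrightarrow>
     (\<forall>x\<in>carrier S. d x \<in> carrier S) \<and>
     (\<forall>x\<in>carrier S. \<forall>y\<in>carrier S. d (x \<oplus>\<^bsub>S\<^esub> y) = d x \<oplus>\<^bsub>S\<^esub> d y) \<and>
     (\<forall>x\<in>carrier S. \<forall>y\<in>carrier S. d (x \<otimes>\<^bsub>S\<^esub> y) = d x \<otimes>\<^bsub>S\<^esub> y \<oplus>\<^bsub>S\<^esub> x \<otimes>\<^bsub>S\<^esub> d y)"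

definition relative_derivation :: "('s, 'c) ring_scheme \<Rightarrow> 's set \<Rightarrow> ('s \<Rightarrow> 's) \<Rightarrow> bool" where
  "relative_derivation S A d \<longleftrightarrow> derivation S d \<and> (\<forall>x\<in>A. d x = \<zero>\<^bsub>S\<^esub>)"

definition inner_derivation :: "('s, 'c) ring_scheme \<Rightarrow> ('s \<Rightarrow> 's) \<Rightarrow> bool" where
  "inner_derivation S d \<longleftrightarrow>
     (\<exists>a\<in>carrier S. \<forall>x\<in>carrier S. d x = a \<otimes>\<^bsub>S\<^esub> x \<ominus>\<^bsub>S\<^esub> x \<otimes>\<^bsub>S\<^esub> a)"

text \<open>The product is the bilinear extension of the rule \<open>(a g)(b h) = a b \<alpha>(g, h) g h\<close>.\<close>

lemma (in assoc_algebra) tgr_monom_mult: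
  assumes G: "group G" and "two_cocycle K G \<alpha>"
    and "a \<in> carrier R" "b \<in> carrier R" "g \<in> carrier G" "h \<in> carrier G"
  shows "tgr_monom R a g \<otimes>\<^bsub>twisted_group_ring R G \<alpha>\<^esub> tgr_monom R b h
           = tgr_monom R (\<alpha> g h \<odot>\<^bsub>R\<^esub> (a \<otimes>\<^bsub>R\<^esub> b)) (g \<otimes>\<^bsub>G\<^esub> h)"
proof
  fix x
  have \<alpha>: "\<alpha> g h \<in> carrier K"
    using assms by (auto simp: two_cocycle_def Units_def)
  have z: "c \<odot>\<^bsub>R\<^esub> \<zero>\<^bsub>R\<^esub> = \<zero>\<^bsub>R\<^esub>" if "c \<in> carrier K" for c
    using that by simp
  let ?S = "{(g', h'). g' \<in> tgr_supp R G (tgr_monom R a g) \<and>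
              h' \<in> tgr_supp R G (tgr_monom R b h) \<and> g' \<otimes>\<^bsub>G\<^esub> h' = x}"
  have S: "?S = (if a \<noteq> \<zero>\<^bsub>R\<^esub> \<and> b \<noteq> \<zero>\<^bsub>R\<^esub> \<and> g \<otimes>\<^bsub>G\<^esub> h = x then {(g, h)} else {})"
    using assms by (auto simp: tgr_supp_def tgr_monom_def split: if_splits)
  show "(tgr_monom R a g \<otimes>\<^bsub>twisted_group_ring R G \<alpha>\<^esub> tgr_monom R b h) x
           = tgr_monom R (\<alpha> g h \<odot>\<^bsub>R\<^esub> (a \<otimes>\<^bsub>R\<^esub> b)) (g \<otimes>\<^bsub>G\<^esub> h) x"
    unfolding twisted_group_ring_def monoid.simps S
    using assms \<alpha> z by (auto simp: tgr_monom_def M.finsum_insert)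
qed

end

theory Submission
  imports Defs
begin

text \<open>
  Let \<open>S\<close> be the twisted group ring, \<open>u g\<close> its basis element at \<open>g\<close>, and \<open>Z\<close> the
  \<open>\<alpha>\<close>-center of \<open>G\<close>. The proof is an averaging argument over the finite group \<open>G / Z\<close>.

  For \<open>z \<in> Z\<close> the unit \<open>u z\<close> is central in \<open>S\<close>, and since \<open>G\<close> is torsion some power
  \<open>u z ^ n\<close>, with \<open>n\<close> the order of \<open>z\<close>, is a scalar. The power rule then gives
  \<open>n (u z) ^ (n - 1) d (u z) = 0\<close>, and, unless \<open>R = 0\<close>, the assumption on
  characteristics makes \<open>n\<close> invertible in \<open>K\<close>, so \<open>d\<close> kills \<open>u z\<close>
  (\<open>derivation_zero_if_pow_constant\<close>, \<open>basis_alpha_center_central\<close>, \<open>basis_pow\<close>).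

  The logarithmic derivative \<open>f g = d (u g) (u g)\<^sup>-\<^sup>1\<close> does not see the scalars \<open>\<alpha> g h\<close> and
  so satisfies the cocycle identity \<open>f (g h) = f g + u g f h (u g)\<^sup>-\<^sup>1\<close>. As \<open>f\<close> vanishes on
  \<open>Z\<close>, it descends to \<open>G / Z\<close>. Let \<open>m\<close> be the order of \<open>G / Z\<close> and \<open>A\<close> the sum of \<open>f\<close> over
  \<open>G / Z\<close>. Summing the identity over \<open>h\<close> gives \<open>A = m f g + u g A (u g)\<^sup>-\<^sup>1\<close>, so that
  \<open>a = A / m\<close> satisfies \<open>d (u g) = a u g - u g a\<close>
  (\<open>derivation_inner_on_projective_representation\<close>). Division by \<open>m\<close> is possible because,
  by Cauchy's theorem in \<open>G / Z\<close>, a prime dividing \<open>m\<close> divides the order of an element of \<open>G\<close>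
  (\<open>prime_dvd_index_imp_dvd_ord\<close>). Finally \<open>a\<close> commutes with \<open>R\<close>, because \<open>R\<close> is killed by \<open>d\<close>
  and commutes with every \<open>u g\<close>, so \<open>d\<close> and the inner derivation of \<open>a\<close> agree on
  \<open>r u g\<close> and hence on \<open>S\<close>.
\<close>

section \<open>Averaging logarithmic derivatives\<close>

context ring
begin

lemma derivation_closed:
  "\<lbrakk>derivation R d; x \<in> carrier R\<rbrakk> \<Longrightarrow> d x \<in> carrier R"
  by (simp add: derivation_def)

lemma derivation_mult:
  "\<lbrakk>derivation R d; x \<in> carrier R; y \<in> carrier R\<rbrakk> \<Longrightarrow> d (x \<otimes> y) = d x \<otimes> y \<oplus> x \<otimes> d y"
  by (simp add: derivation_def)

lemma derivation_one:
  assumes "derivation R d"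
  shows "d \<one> = \<zero>"
proof -
  have "d \<one> \<in> carrier R" using assms by (simp add: derivation_closed)
  then show ?thesis
    using derivation_mult[OF assms one_closed one_closed] by (metis add.r_cancel_one l_one r_one one_closed)
qed

lemma derivation_pow_commuting:
  fixes n :: nat
  assumes d: "derivation R d" and x: "x \<in> carrier R" and comm: "x \<otimes> d x = d x \<otimes> x"
  shows "x \<otimes> d (x [^] n) = [n] \<cdot> (x [^] n \<otimes> d x)"
proof (induction n)
  case 0
  then show ?case using derivation_one[OF d] x by simp
next
  case (Suc n)
  have dx: "d x \<in> carrier R" "d (x [^] n) \<in> carrier R"
    using derivation_closed[OF d] x by auto
  have xn: "x [^] n \<otimes> x = x \<otimes> x [^] n"
    using x by (metis nat_pow_Suc nat_pow_Suc2)
  have "x \<otimes> d (x [^] Suc n) = x \<otimes> (d (x [^] n) \<otimes> x \<oplus> x [^] n \<otimes> d x)"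
    using derivation_mult[OF d] x by simp
  also have "\<dots> = (x \<otimes> d (x [^] n)) \<otimes> x \<oplus> (x \<otimes> x [^] n) \<otimes> d x"
    using x dx by (simp add: r_distr m_assoc)
  also have "\<dots> = [n] \<cdot> (x [^] n \<otimes> d x) \<otimes> x \<oplus> (x [^] n \<otimes> x) \<otimes> d x"
    using Suc xn by simp
  also have "[n] \<cdot> (x [^] n \<otimes> d x) \<otimes> x = [n] \<cdot> ((x [^] n \<otimes> x) \<otimes> d x)"
    using x dx by (simp add: add_pow_ldistr m_assoc comm)
  finally show ?case using x dx by (simp add: add.nat_pow_Suc)
qed

lemma add_pow_Units_cancel:
  assumes "[(n::nat)] \<cdot> \<one> \<in> Units R" "y \<in> carrier R" "[n] \<cdot> y = \<zero>"
  shows "y = \<zero>"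
proof -
  have "([n] \<cdot> \<one>) \<otimes> y = \<zero>"
    using assms by (simp add: add_pow_ldistr)
  then show ?thesis
    using assms by (metis Units_closed Units_l_cancel r_null zero_closed)
qed

text \<open>Since \<open>x\<close> commutes with \<open>d x\<close>, the power rule turns \<open>d (x ^ n) = 0\<close> into
  \<open>n x ^ (n - 1) d x = 0\<close>, in which everything but \<open>d x\<close> can be cancelled.\<close>

lemma derivation_zero_if_pow_constant:
  assumes d: "derivation R d" and x: "x \<in> Units R" and comm: "x \<otimes> d x = d x \<otimes> x"
    and n: "[(n::nat)] \<cdot> \<one> \<in> Units R" and xn: "d (x [^] n) = \<zero>"
  shows "d x = \<zero>"
proof -
  have [simp]: "x \<in> carrier R" "d x \<in> carrier R"
    using x derivation_closed[OF d] by auto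
  have "x [^] n \<otimes> d x = \<zero>"
    using derivation_pow_commuting[OF d _ comm, of n] xn add_pow_Units_cancel[OF n] by simp
  moreover have "x [^] n \<in> Units R"
    using x by (rule Units_pow_closed)
  ultimately show ?thesis
    by (metis Units_closed Units_l_cancel r_null zero_closed \<open>d x \<in> carrier R\<close>)
qed

text \<open>The noncommutative logarithmic derivative. It obeys a twisted sum rule and is insensitive
  to central units killed by \<open>d\<close>, which is what removes the \<open>2\<close>-cocycle from the problem.\<close>

definition logder :: "('a \<Rightarrow> 'a) \<Rightarrow> 'a \<Rightarrow> 'a" where
  "logder d x = d x \<otimes> inv x"

lemma logder_closed:
  "\<lbrakk>derivation R d; x \<in> Units R\<rbrakk> \<Longrightarrow> logder d x \<in> carrier R"
  by (simp add: logder_def derivation_closed Units_closed)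

lemma logder_mult:
  assumes d: "derivation R d" and x: "x \<in> Units R" and y: "y \<in> Units R"
  shows "logder d (x \<otimes> y) = logder d x \<oplus> x \<otimes> logder d y \<otimes> inv x"
proof -
  have [simp]: "x \<in> carrier R" "y \<in> carrier R" "inv x \<in> carrier R" "inv y \<in> carrier R"
    "d x \<in> carrier R" "d y \<in> carrier R"
    using x y derivation_closed[OF d] by auto
  have "inv (x \<otimes> y) = inv y \<otimes> inv x"
  proof (rule inv_char)
    show "x \<otimes> y \<otimes> (inv y \<otimes> inv x) = \<one>"
    proof -
      have "x \<otimes> y \<otimes> (inv y \<otimes> inv x) = x \<otimes> (y \<otimes> inv y) \<otimes> inv x"
        using x y by (simp only: m_assoc Units_closed Units_inv_closed m_closed)
      then show ?thesis using x y by simp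
    qed
    show "inv y \<otimes> inv x \<otimes> (x \<otimes> y) = \<one>"
    proof -
      have "inv y \<otimes> inv x \<otimes> (x \<otimes> y) = inv y \<otimes> (inv x \<otimes> x) \<otimes> y"
        using x y by (simp only: m_assoc Units_closed Units_inv_closed m_closed)
      then show ?thesis using x y by simp
    qed
  qed simp_all
  then have "logder d (x \<otimes> y) = d x \<otimes> (y \<otimes> inv y) \<otimes> inv x \<oplus> x \<otimes> (d y \<otimes> inv y) \<otimes> inv x"
    unfolding logder_def derivation_mult[OF d \<open>x \<in> carrier R\<close> \<open>y \<in> carrier R\<close>]
    by (simp add: l_distr m_assoc)
  then show ?thesis using y by (simp add: logder_def)
qed

lemma commutes_inv:
  assumes "x \<in> carrier R" "y \<in> Units R" "x \<otimes> y = y \<otimes> x"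
  shows "x \<otimes> inv y = inv y \<otimes> x"
proof -
  have c: "y \<in> carrier R" "inv y \<in> carrier R" using assms by auto
  have "inv y \<otimes> (x \<otimes> y) \<otimes> inv y = inv y \<otimes> x"
    using assms(1,2) c by (simp add: m_assoc)
  moreover have "inv y \<otimes> (y \<otimes> x) \<otimes> inv y = x \<otimes> inv y"
    using assms(1,2) c by (simp add: m_assoc[symmetric])
  ultimately show ?thesis using assms(3) by simp
qed

lemma add_pow_one_commutes:
  "x \<in> carrier R \<Longrightarrow> x \<otimes> ([(n::nat)] \<cdot> \<one>) = ([n] \<cdot> \<one>) \<otimes> x"
  by (simp add: add_pow_ldistr add_pow_rdistr)

text \<open>A form of the averaging argument in Maschke's theorem: \<open>u\<close> is a representation of \<open>G\<close> up
  to central constants, so \<open>g \<mapsto> logder d (u g)\<close> is a \<open>1\<close>-cocycle on \<open>G / N\<close>, and when the index is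
  invertible it is the coboundary of its average. Everything entering the average lies in the
  centralizer of the constants that commute with all \<open>u g\<close>, whence the last conclusion.\<close>

theorem derivation_inner_on_projective_representation:
  fixes G :: "('g, 'c) monoid_scheme" and u :: "'g \<Rightarrow> 'a"
  assumes d: "derivation R d" and N: "N \<lhd> G" and fin: "finite (rcosets\<^bsub>G\<^esub> N)"
    and m: "[card (rcosets\<^bsub>G\<^esub> N)] \<cdot> \<one> \<in> Units R"
    and u: "\<And>g. g \<in> carrier G \<Longrightarrow> u g \<in> Units R"
    and mult: "\<And>g h. \<lbrakk>g \<in> carrier G; h \<in> carrier G\<rbrakk> \<Longrightarrow>
      \<exists>c\<in>Units R. d c = \<zero> \<and> (\<forall>x\<in>carrier R. c \<otimes> x = x \<otimes> c) \<and>
                  u g \<otimes> u h = c \<otimes> u (g \<otimes>\<^bsub>G\<^esub> h)"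
    and dN: "\<And>z. z \<in> N \<Longrightarrow> d (u z) = \<zero>"
  obtains a where "a \<in> carrier R"
    and "\<And>g. g \<in> carrier G \<Longrightarrow> d (u g) = a \<otimes> u g \<ominus> u g \<otimes> a"
    and "\<And>x. \<lbrakk>x \<in> carrier R; d x = \<zero>; \<And>g. g \<in> carrier G \<Longrightarrow> x \<otimes> u g = u g \<otimes> x\<rbrakk>
           \<Longrightarrow> x \<otimes> a = a \<otimes> x"
proof -
  interpret N: normal N G by fact
  define f where "f g = logder d (u g)" for g
  have uc [simp]: "u g \<in> carrier R" "inv (u g) \<in> carrier R" "d (u g) \<in> carrier R"
    if "g \<in> carrier G" for g
    using u[OF that] derivation_closed[OF d] by auto
  have fc [simp]: "f g \<in> carrier R" if "g \<in> carrier G" for g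
    using u[OF that] d by (simp add: f_def logder_closed)
  have cocycle: "f (g \<otimes>\<^bsub>G\<^esub> h) = f g \<oplus> u g \<otimes> f h \<otimes> inv (u g)"
    if g: "g \<in> carrier G" and h: "h \<in> carrier G" for g h
  proof -
    obtain c where c: "c \<in> Units R" "d c = \<zero>" "\<forall>x\<in>carrier R. c \<otimes> x = x \<otimes> c"
      and uu: "u g \<otimes> u h = c \<otimes> u (g \<otimes>\<^bsub>G\<^esub> h)"
      using mult[OF g h] by blast
    have gh: "g \<otimes>\<^bsub>G\<^esub> h \<in> carrier G" using g h by simp
    have cc: "c \<in> carrier R" "inv c \<in> carrier R" using c by auto
    have "logder d (c \<otimes> u (g \<otimes>\<^bsub>G\<^esub> h)) = (c \<otimes> f (g \<otimes>\<^bsub>G\<^esub> h)) \<otimes> inv c"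
      using logder_mult[OF d c(1) u[OF gh]] c(2) cc fc[OF gh]
      by (simp add: f_def[symmetric]) (simp add: logder_def)
    also have "\<dots> = (f (g \<otimes>\<^bsub>G\<^esub> h) \<otimes> c) \<otimes> inv c" using c(3) fc[OF gh] by simp
    also have "\<dots> = f (g \<otimes>\<^bsub>G\<^esub> h)" using c(1) cc fc[OF gh] by (simp add: m_assoc)
    finally show ?thesis
      using logder_mult[OF d u[OF g] u[OF h]] by (simp add: uu f_def)
  qed
  have f_N: "f z = \<zero>" if "z \<in> N" for z
    using dN[OF that] uc that N.subset by (auto simp: f_def logder_def)
  \<comment> \<open>The cocycle identity at \<open>h z\<close> with \<open>f z = 0\<close> makes \<open>f\<close> constant on \<open>h N\<close>, which is
    \<open>N h\<close>; hence the choice of a representative is immaterial.\<close>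
  define F where "F C = f (SOME h. h \<in> C)" for C
  have F: "F (N #>\<^bsub>G\<^esub> h) = f h" if h: "h \<in> carrier G" for h
  proof -
    have "h \<in> N #>\<^bsub>G\<^esub> h" by (rule N.rcos_self[OF h N.subgroup_axioms])
    then have "(SOME h'. h' \<in> N #>\<^bsub>G\<^esub> h) \<in> N #>\<^bsub>G\<^esub> h" by (rule someI)
    moreover have "N #>\<^bsub>G\<^esub> h = h <#\<^bsub>G\<^esub> N" using N.coset_eq h by (rule bspec)
    ultimately obtain z where z: "z \<in> N" "(SOME h'. h' \<in> N #>\<^bsub>G\<^esub> h) = h \<otimes>\<^bsub>G\<^esub> z"
      unfolding l_coset_def by blast
    have zG: "z \<in> carrier G" using z N.subset by auto
    show ?thesis unfolding F_def z(2) cocycle[OF h zG] f_N[OF z(1)]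
      using fc[OF h] uc[OF h] by (simp only: r_null l_null r_zero)
  qed
  have Fc: "F \<in> rcosets\<^bsub>G\<^esub> N \<rightarrow> carrier R"
    by (auto simp: RCOSETS_def F)
  define A where "A = finsum R F (rcosets\<^bsub>G\<^esub> N)"
  define w where "w = [card (rcosets\<^bsub>G\<^esub> N)] \<cdot> \<one>"
  have Ac [simp]: "A \<in> carrier R" unfolding A_def using Fc by (rule finsum_closed)
  have w: "w \<in> Units R" and wc [simp]: "w \<in> carrier R" "inv w \<in> carrier R"
    using m by (auto simp: w_def)
  have w_comm: "x \<otimes> inv w = inv w \<otimes> x" if "x \<in> carrier R" for x
    using commutes_inv[OF that w] add_pow_one_commutes[OF that] by (simp add: w_def)
  have avg: "A = w \<otimes> f g \<oplus> u g \<otimes> A \<otimes> inv (u g)" if g: "g \<in> carrier G" for g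
  proof -
    let ?t = "\<lambda>C. (N #>\<^bsub>G\<^esub> g) <#>\<^bsub>G\<^esub> C"
    interpret Q: group "G Mod N" by (rule N.factorgroup_is_group)
    have gQ: "N #>\<^bsub>G\<^esub> g \<in> carrier (G Mod N)"
      using g by (auto simp: FactGroup_def RCOSETS_def)
    have inj: "inj_on ?t (rcosets\<^bsub>G\<^esub> N)"
      using Q.inj_on_cmult[OF gQ] by (simp add: FactGroup_def)
    have surj: "?t ` (rcosets\<^bsub>G\<^esub> N) = rcosets\<^bsub>G\<^esub> N"
      using Q.surj_const_mult[OF gQ] by (simp add: FactGroup_def)
    \<comment> \<open>Translation by the coset of \<open>g\<close> permutes the cosets, so it does not change the sum.\<close>
    have "A = finsum R (\<lambda>C. F (?t C)) (rcosets\<^bsub>G\<^esub> N)"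
      unfolding A_def using finsum_reindex[of F ?t "rcosets\<^bsub>G\<^esub> N"] inj surj Fc by simp
    also have "\<dots> = finsum R (\<lambda>C. f g \<oplus> u g \<otimes> F C \<otimes> inv (u g)) (rcosets\<^bsub>G\<^esub> N)"
    proof (rule finsum_cong')
      show "(\<lambda>C. f g \<oplus> u g \<otimes> F C \<otimes> inv (u g)) \<in> rcosets\<^bsub>G\<^esub> N \<rightarrow> carrier R"
        using Fc g by (auto simp: Pi_iff)
      fix C assume "C \<in> rcosets\<^bsub>G\<^esub> N"
      then obtain h where h: "h \<in> carrier G" "C = N #>\<^bsub>G\<^esub> h" by (auto simp: RCOSETS_def)
      show "F (?t C) = f g \<oplus> u g \<otimes> F C \<otimes> inv (u g)"
        using g h by (simp add: N.rcos_sum F cocycle)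
    qed simp
    also have "\<dots> = finsum R (\<lambda>C. f g) (rcosets\<^bsub>G\<^esub> N) \<oplus>
        finsum R (\<lambda>C. u g \<otimes> F C \<otimes> inv (u g)) (rcosets\<^bsub>G\<^esub> N)"
      by (rule finsum_addf) (use Fc g in \<open>auto simp: Pi_iff\<close>)
    also have "finsum R (\<lambda>C. f g) (rcosets\<^bsub>G\<^esub> N) = w \<otimes> f g"
      using g by (simp add: add.finprod_const w_def add_pow_ldistr)
    also have "finsum R (\<lambda>C. u g \<otimes> F C \<otimes> inv (u g)) (rcosets\<^bsub>G\<^esub> N)
        = u g \<otimes> A \<otimes> inv (u g)"
    proof -
      have "u g \<otimes> A \<otimes> inv (u g)
          = finsum R (\<lambda>C. u g \<otimes> F C) (rcosets\<^bsub>G\<^esub> N) \<otimes> inv (u g)"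
        unfolding A_def using fin g Fc by (simp add: finsum_rdistr)
      also have "\<dots> = finsum R (\<lambda>C. u g \<otimes> F C \<otimes> inv (u g)) (rcosets\<^bsub>G\<^esub> N)"
        by (rule finsum_ldistr) (use fin g Fc in \<open>auto simp: Pi_iff\<close>)
      finally show ?thesis by simp
    qed
    finally show ?thesis .
  qed
  define a where "a = inv w \<otimes> A"
  have ac [simp]: "a \<in> carrier R" by (simp add: a_def)
  show thesis
  proof (rule that[of a])
    show "a \<in> carrier R" by simp
  next
    fix g assume g: "g \<in> carrier G"
    let ?u = "u g" and ?v = "inv (u g)"
    have "a = inv w \<otimes> (w \<otimes> f g \<oplus> ?u \<otimes> A \<otimes> ?v)"
      unfolding a_def using avg[OF g] by simp
    also have "\<dots> = (inv w \<otimes> w) \<otimes> f g \<oplus> (inv w \<otimes> ?u) \<otimes> A \<otimes> ?v"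
      using g by (simp add: r_distr m_assoc)
    also have "\<dots> = f g \<oplus> ?u \<otimes> a \<otimes> ?v"
      using g w by (simp add: w_comm[symmetric] m_assoc a_def)
    finally have "a \<otimes> ?u = (f g \<oplus> ?u \<otimes> a \<otimes> ?v) \<otimes> ?u" by simp
    also have "\<dots> = d ?u \<oplus> ?u \<otimes> a"
      using g u[OF g] by (simp add: l_distr m_assoc f_def logder_def)
    finally show "d ?u = a \<otimes> ?u \<ominus> ?u \<otimes> a"
      using g by (simp add: minus_eq a_assoc r_neg)
  next
    fix x
    assume x: "x \<in> carrier R" "d x = \<zero>"
      and xu: "\<And>g. g \<in> carrier G \<Longrightarrow> x \<otimes> u g = u g \<otimes> x"
    have xf: "x \<otimes> f g = f g \<otimes> x" if g: "g \<in> carrier G" for g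
    proof -
      have "x \<otimes> d (u g) = d (x \<otimes> u g)"
        using derivation_mult[OF d x(1)] x g by simp
      also have "\<dots> = d (u g) \<otimes> x"
        unfolding xu[OF g] using derivation_mult[OF d _ x(1)] x g by simp
      finally have "x \<otimes> f g = d (u g) \<otimes> (x \<otimes> inv (u g))"
        using g x by (simp add: f_def logder_def m_assoc[symmetric])
      then show ?thesis
        using commutes_inv[OF x(1) u[OF g] xu[OF g]] g x by (simp add: f_def logder_def m_assoc)
    qed
    have "x \<otimes> A = finsum R (\<lambda>C. x \<otimes> F C) (rcosets\<^bsub>G\<^esub> N)"
      unfolding A_def using fin x Fc by (simp add: finsum_rdistr)
    also have "\<dots> = finsum R (\<lambda>C. F C \<otimes> x) (rcosets\<^bsub>G\<^esub> N)"
    proof (rule finsum_cong')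
      show "(\<lambda>C. F C \<otimes> x) \<in> rcosets\<^bsub>G\<^esub> N \<rightarrow> carrier R" using Fc x by (auto simp: Pi_iff)
      show "\<And>C. C \<in> rcosets\<^bsub>G\<^esub> N \<Longrightarrow> x \<otimes> F C = F C \<otimes> x"
        by (auto simp: RCOSETS_def F xf)
    qed simp
    also have "\<dots> = A \<otimes> x"
      unfolding A_def using fin x Fc by (simp add: finsum_ldistr)
    finally have xA: "x \<otimes> A = A \<otimes> x" .
    have "x \<otimes> a = (x \<otimes> inv w) \<otimes> A" using x by (simp add: a_def m_assoc)
    also have "\<dots> = inv w \<otimes> (x \<otimes> A)" using x by (simp add: w_comm m_assoc)
    also have "\<dots> = a \<otimes> x" using x by (simp add: xA a_def m_assoc)
    finally show "x \<otimes> a = a \<otimes> x" .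
  qed
qed

end

section \<open>Primes dividing an index\<close>

text \<open>The least divisor of \<open>n\<close> that annihilates \<open>1\<close> must be prime, by the absence of zero
  divisors.\<close>

lemma (in domain) prime_annihilating_one:
  "\<lbrakk>(n::nat) > 0; [n] \<cdot> \<one> = \<zero>\<rbrakk> \<Longrightarrow> \<exists>p. Factorial_Ring.prime p \<and> p dvd n \<and> [p] \<cdot> \<one> = \<zero>"
proof (induction n rule: less_induct)
  case (less n)
  have "n \<noteq> 1" using less.prems by auto
  then obtain p where p: "Factorial_Ring.prime p" "p dvd n"
    by (meson prime_factor_nat)
  then obtain m where m: "n = p * m" by blast
  have "([p] \<cdot> \<one>) \<otimes> ([m] \<cdot> \<one>) = [n] \<cdot> \<one>"
    by (simp add: add_pow_ldistr add.nat_pow_pow m mult.commute)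
  then consider "[p] \<cdot> \<one> = \<zero>" | "[m] \<cdot> \<one> = \<zero>"
    using less.prems(2) integral by auto
  then show ?case
  proof cases
    case 1
    then show ?thesis using p by blast
  next
    case 2
    have "0 < m" "m < n"
      using m less.prems(1) prime_gt_1_nat[OF p(1)] by auto
    then obtain q where "Factorial_Ring.prime q" "q dvd m" "[q] \<cdot> \<one> = \<zero>"
      using less.IH 2 by blast
    then show ?thesis using m by auto
  qed
qed

text \<open>Cauchy's theorem in the quotient gives a coset of order \<open>p\<close>, and the order of a coset
  divides the order of each of its members.\<close>

lemma (in group) prime_dvd_index_imp_dvd_ord:
  assumes N: "N \<lhd> G" and fin: "finite (rcosets N)"
    and p: "Factorial_Ring.prime p" "p dvd card (rcosets N)"
  shows "\<exists>g\<in>carrier G. p dvd ord g"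
proof -
  interpret N: normal N G by fact
  let ?Q = "G Mod N"
  interpret Q: group ?Q by (rule N.factorgroup_is_group)
  have carQ: "carrier ?Q = rcosets N" by (simp add: FactGroup_def)
  obtain m where "card (rcosets N) = p * m" using p by blast
  then have "order ?Q = p ^ 1 * m" by (simp add: order_def carQ)
  then obtain H where H: "subgroup H ?Q" "card H = p ^ 1"
    using sylow_thm[OF p(1) Q.group_axioms, of 1 m] fin carQ by auto
  interpret H: group "?Q\<lparr>carrier := H\<rparr>"
    using H(1) by (rule Q.subgroup_imp_group)
  have "\<one>\<^bsub>?Q\<^esub> \<in> H" using H(1) by (rule subgroup.one_closed)
  moreover have "1 < card H" using H(2) prime_gt_1_nat[OF p(1)] by simp
  ultimately obtain C where C: "C \<in> H" "C \<noteq> \<one>\<^bsub>?Q\<^esub>"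
    by (metis card_le_Suc0_iff_eq One_nat_def card.infinite leD not_less_eq_eq zero_less_one less_trans not_one_less_zero)
  have CQ: "C \<in> carrier ?Q" using C(1) H(1) subgroup.subset by blast
  have "C [^]\<^bsub>?Q\<lparr>carrier := H\<rparr>\<^esub> p = \<one>\<^bsub>?Q\<lparr>carrier := H\<rparr>\<^esub>"
    using H.pow_order_eq_1[of C] C H(2) by (simp add: order_def)
  then have "C [^]\<^bsub>?Q\<^esub> p = \<one>\<^bsub>?Q\<^esub>"
    by (simp add: Q.nat_pow_consistent[symmetric])
  then have "Q.ord C dvd p" using Q.pow_eq_id[OF CQ] by simp
  then have ordC: "Q.ord C = p"
    using p(1) Q.ord_eq_1[OF CQ] C(2) by (auto simp: prime_nat_iff)
  obtain g where g: "g \<in> carrier G" "C = N #> g"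
    using CQ by (auto simp: carQ RCOSETS_def)
  interpret h: group_hom G ?Q "\<lambda>g. N #> g"
    by (simp add: group_hom_def group_hom_axioms_def Q.group_axioms group_axioms N.r_coset_hom_Mod)
  have "C [^]\<^bsub>?Q\<^esub> ord g = N #> (g [^] ord g)"
    unfolding g(2) using g(1) by (rule h.hom_nat_pow[symmetric])
  also have "\<dots> = \<one>\<^bsub>?Q\<^esub>" using g(1) h.hom_one by simp
  finally have "p dvd ord g" using Q.pow_eq_id[OF CQ] ordC by simp
  then show ?thesis using g(1) by blast
qed

section \<open>The twisted group ring is a ring\<close>

locale twisted_group_algebra = assoc_algebra K R + G: group G
  for K :: "('k, 'a) ring_scheme" and R :: "('k, 'r, 'b) module_scheme"
    and G :: "('g, 'c) monoid_scheme" +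
  fixes \<alpha> :: "'g \<Rightarrow> 'g \<Rightarrow> 'k"
  assumes cocycle: "normalized_two_cocycle K G \<alpha>"
begin

abbreviation S where "S \<equiv> twisted_group_ring R G \<alpha>"
abbreviation supp where "supp \<equiv> tgr_supp R G"
abbreviation monom where "monom \<equiv> tgr_monom R"

lemma two_cocycle: "two_cocycle K G \<alpha>"
  using cocycle by (simp add: normalized_two_cocycle_def)

lemma cocycle_Units: "\<lbrakk>g \<in> carrier G; h \<in> carrier G\<rbrakk> \<Longrightarrow> \<alpha> g h \<in> Units K"
  using two_cocycle by (simp add: two_cocycle_def)

lemma cocycle_closed [simp]: "\<lbrakk>g \<in> carrier G; h \<in> carrier G\<rbrakk> \<Longrightarrow> \<alpha> g h \<in> carrier K"
  using cocycle_Units by blast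

lemma cocycle_eq:
  "\<lbrakk>x \<in> carrier G; y \<in> carrier G; z \<in> carrier G\<rbrakk> \<Longrightarrow>
    \<alpha> x y \<otimes>\<^bsub>K\<^esub> \<alpha> (x \<otimes>\<^bsub>G\<^esub> y) z = \<alpha> y z \<otimes>\<^bsub>K\<^esub> \<alpha> x (y \<otimes>\<^bsub>G\<^esub> z)"
  using two_cocycle by (simp add: two_cocycle_def)

lemma cocycle_one [simp]:
  "g \<in> carrier G \<Longrightarrow> \<alpha> \<one>\<^bsub>G\<^esub> g = \<one>\<^bsub>K\<^esub>" "g \<in> carrier G \<Longrightarrow> \<alpha> g \<one>\<^bsub>G\<^esub> = \<one>\<^bsub>K\<^esub>"
  using cocycle by (auto simp: normalized_two_cocycle_def)

lemma tgr_carrier_iff: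
  "u \<in> carrier S \<longleftrightarrow> (\<forall>g\<in>carrier G. u g \<in> carrier R) \<and>
     (\<forall>g. g \<notin> carrier G \<longrightarrow> u g = \<zero>\<^bsub>R\<^esub>) \<and> finite (supp u)"
  by (simp add: twisted_group_ring_def)

lemma tgr_zero: "\<zero>\<^bsub>S\<^esub> = (\<lambda>g. \<zero>\<^bsub>R\<^esub>)"
  by (simp add: twisted_group_ring_def)

lemma tgr_one: "\<one>\<^bsub>S\<^esub> = monom \<one>\<^bsub>R\<^esub> \<one>\<^bsub>G\<^esub>"
  by (auto simp: twisted_group_ring_def tgr_monom_def)

lemma tgr_add: "u \<oplus>\<^bsub>S\<^esub> v = (\<lambda>g. u g \<oplus>\<^bsub>R\<^esub> v g)"
  by (simp add: twisted_group_ring_def)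

lemma tgr_mult:
  "(u \<otimes>\<^bsub>S\<^esub> v) x = finsum R (\<lambda>(g, h). \<alpha> g h \<odot>\<^bsub>R\<^esub> (u g \<otimes>\<^bsub>R\<^esub> v h))
     {(g, h). g \<in> supp u \<and> h \<in> supp v \<and> g \<otimes>\<^bsub>G\<^esub> h = x}"
  by (simp add: twisted_group_ring_def)

lemma tgr_carrierI:
  assumes "\<And>g. g \<in> carrier G \<Longrightarrow> u g \<in> carrier R" "\<And>g. g \<notin> carrier G \<Longrightarrow> u g = \<zero>\<^bsub>R\<^esub>"
    and "supp u \<subseteq> F" "finite F"
  shows "u \<in> carrier S"
  using assms finite_subset unfolding tgr_carrier_iff by blast

lemma tgr_coeff_outside: "\<lbrakk>u \<in> carrier S; g \<notin> carrier G\<rbrakk> \<Longrightarrow> u g = \<zero>\<^bsub>R\<^esub>"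
  unfolding tgr_carrier_iff by blast

lemma tgr_coeff_closed [simp]: "u \<in> carrier S \<Longrightarrow> u g \<in> carrier R"
  unfolding tgr_carrier_iff by (cases "g \<in> carrier G") auto

lemma tgr_finite_supp [simp]: "u \<in> carrier S \<Longrightarrow> finite (supp u)"
  unfolding tgr_carrier_iff by blast

lemma tgr_monom_closed [simp]: "\<lbrakk>a \<in> carrier R; g \<in> carrier G\<rbrakk> \<Longrightarrow> monom a g \<in> carrier S"
  by (rule tgr_carrierI[of _ "{g}"]) (auto simp: tgr_supp_def tgr_monom_def)

lemma tgr_add_closed:
  assumes u: "u \<in> carrier S" and v: "v \<in> carrier S"
  shows "u \<oplus>\<^bsub>S\<^esub> v \<in> carrier S"
  by (rule tgr_carrierI[of _ "supp u \<union> supp v"])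
     (use u v in \<open>auto simp: tgr_add tgr_supp_def[of R G "\<lambda>g. u g \<oplus>\<^bsub>R\<^esub> v g"] tgr_coeff_outside\<close>,
      auto simp: tgr_supp_def)

lemma tgr_abelian_group: "abelian_group S"
proof (rule abelian_groupI)
  fix u assume u: "u \<in> carrier S"
  have "(\<lambda>g. \<ominus>\<^bsub>R\<^esub> u g) \<in> carrier S"
    by (rule tgr_carrierI[of _ "supp u"])
       (use u in \<open>auto simp: tgr_supp_def[of R G "\<lambda>g. \<ominus>\<^bsub>R\<^esub> u g"] tgr_coeff_outside\<close>,
        auto simp: tgr_supp_def)
  moreover have "(\<lambda>g. \<ominus>\<^bsub>R\<^esub> u g) \<oplus>\<^bsub>S\<^esub> u = \<zero>\<^bsub>S\<^esub>"
    using u by (simp add: tgr_add tgr_zero M.l_neg)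
  ultimately show "\<exists>v\<in>carrier S. v \<oplus>\<^bsub>S\<^esub> u = \<zero>\<^bsub>S\<^esub>" by blast
next
  show "\<zero>\<^bsub>S\<^esub> \<in> carrier S"
    by (rule tgr_carrierI[of _ "{}"]) (auto simp: tgr_zero tgr_supp_def)
next
  fix u v w assume c: "u \<in> carrier S" "v \<in> carrier S" "w \<in> carrier S"
  show "u \<oplus>\<^bsub>S\<^esub> v \<in> carrier S" using c by (simp add: tgr_add_closed)
  show "u \<oplus>\<^bsub>S\<^esub> v = v \<oplus>\<^bsub>S\<^esub> u" using c by (simp add: tgr_add M.a_comm)
  show "u \<oplus>\<^bsub>S\<^esub> v \<oplus>\<^bsub>S\<^esub> w = u \<oplus>\<^bsub>S\<^esub> (v \<oplus>\<^bsub>S\<^esub> w)" using c by (simp add: tgr_add M.a_assoc)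
  show "\<zero>\<^bsub>S\<^esub> \<oplus>\<^bsub>S\<^esub> u = u" using c by (simp add: tgr_add tgr_zero)
qed

text \<open>Solving \<open>g h = x\<close> for \<open>h\<close> turns the sum over pairs into a sum over one variable. The
  index set \<open>F\<close> may be any finite set containing the support, so that products with different
  left factors can be compared term by term; this gives the distributive laws.\<close>

lemma tgr_mult_left_sum:
  assumes u: "u \<in> carrier S" and v: "v \<in> carrier S" and x: "x \<in> carrier G"
    and F: "finite F" "supp u \<subseteq> F" "F \<subseteq> carrier G"
  shows "(u \<otimes>\<^bsub>S\<^esub> v) x
    = finsum R (\<lambda>g. \<alpha> g (inv\<^bsub>G\<^esub> g \<otimes>\<^bsub>G\<^esub> x) \<odot>\<^bsub>R\<^esub> (u g \<otimes>\<^bsub>R\<^esub> v (inv\<^bsub>G\<^esub> g \<otimes>\<^bsub>G\<^esub> x))) F"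
proof -
  let ?p = "\<lambda>g. (g, inv\<^bsub>G\<^esub> g \<otimes>\<^bsub>G\<^esub> x)"
  let ?t = "\<lambda>(g, h). \<alpha> g h \<odot>\<^bsub>R\<^esub> (u g \<otimes>\<^bsub>R\<^esub> v h)"
  let ?B = "{g \<in> supp u. inv\<^bsub>G\<^esub> g \<otimes>\<^bsub>G\<^esub> x \<in> supp v}"
  have set: "{(g, h). g \<in> supp u \<and> h \<in> supp v \<and> g \<otimes>\<^bsub>G\<^esub> h = x} = ?p ` ?B"
  proof -
    have "h = inv\<^bsub>G\<^esub> g \<otimes>\<^bsub>G\<^esub> x" if "g \<in> supp u" "h \<in> supp v" "g \<otimes>\<^bsub>G\<^esub> h = x" for g h
      using that by (auto simp: tgr_supp_def G.m_assoc[symmetric])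
    moreover have "g \<otimes>\<^bsub>G\<^esub> (inv\<^bsub>G\<^esub> g \<otimes>\<^bsub>G\<^esub> x) = x" if "g \<in> supp u" for g
      using that x by (auto simp: tgr_supp_def G.m_assoc[symmetric])
    ultimately show ?thesis by (auto simp: image_iff)
  qed
  have "(u \<otimes>\<^bsub>S\<^esub> v) x = finsum R ?t (?p ` ?B)"
    unfolding tgr_mult set ..
  also have "\<dots> = finsum R (\<lambda>g. ?t (?p g)) ?B"
  proof (rule M.finsum_reindex)
    show "?t \<in> ?p ` ?B \<rightarrow> carrier R" using u v x by (auto simp: tgr_supp_def)
    show "inj_on ?p ?B" by (auto simp: inj_on_def)
  qed
  also have "\<dots> = finsum R (\<lambda>g. ?t (?p g)) F"
  proof (rule M.add.finprod_mono_neutral_cong_left)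
    show "?B \<subseteq> F" using F by auto
    show "(\<lambda>g. ?t (?p g)) \<in> F \<rightarrow> carrier R" using F u v x by auto
    fix g assume g: "g \<in> F - ?B"
    then have "g \<in> carrier G" using F by auto
    then have "u g = \<zero>\<^bsub>R\<^esub> \<or> v (inv\<^bsub>G\<^esub> g \<otimes>\<^bsub>G\<^esub> x) = \<zero>\<^bsub>R\<^esub>" "\<alpha> g (inv\<^bsub>G\<^esub> g \<otimes>\<^bsub>G\<^esub> x) \<in> carrier K"
      using g x by (auto simp: tgr_supp_def)
    then show "?t (?p g) = \<zero>\<^bsub>R\<^esub>" using u v by auto
  qed (use F in auto)
  finally show ?thesis by simp
qed

lemma supp_subset: "supp u \<subseteq> carrier G"
  by (auto simp: tgr_supp_def)

lemma tgr_mult_eq_zero: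
  assumes "\<And>g h. \<lbrakk>g \<in> supp u; h \<in> supp v\<rbrakk> \<Longrightarrow> g \<otimes>\<^bsub>G\<^esub> h \<noteq> x"
  shows "(u \<otimes>\<^bsub>S\<^esub> v) x = \<zero>\<^bsub>R\<^esub>"
proof -
  have empty: "{(g, h). g \<in> supp u \<and> h \<in> supp v \<and> g \<otimes>\<^bsub>G\<^esub> h = x} = {}"
    using assms by blast
  show ?thesis unfolding tgr_mult empty by simp
qed

lemma tgr_mult_outside: "x \<notin> carrier G \<Longrightarrow> (u \<otimes>\<^bsub>S\<^esub> v) x = \<zero>\<^bsub>R\<^esub>"
  by (rule tgr_mult_eq_zero) (auto simp: tgr_supp_def)

lemma tgr_mult_closed:
  assumes u: "u \<in> carrier S" and v: "v \<in> carrier S"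
  shows "u \<otimes>\<^bsub>S\<^esub> v \<in> carrier S"
proof (rule tgr_carrierI)
  show "(u \<otimes>\<^bsub>S\<^esub> v) x \<in> carrier R" for x
    unfolding tgr_mult
    by (rule M.finsum_closed) (use u v in \<open>auto simp: supp_subset[THEN subsetD]\<close>)
  show "(u \<otimes>\<^bsub>S\<^esub> v) x = \<zero>\<^bsub>R\<^esub>" if "x \<notin> carrier G" for x
    using that by (rule tgr_mult_outside)
  show "supp (u \<otimes>\<^bsub>S\<^esub> v) \<subseteq> (\<lambda>(g, h). g \<otimes>\<^bsub>G\<^esub> h) ` (supp u \<times> supp v)"
  proof (rule subsetI, rule ccontr)
    fix x
    assume x: "x \<in> supp (u \<otimes>\<^bsub>S\<^esub> v)" and "x \<notin> (\<lambda>(g, h). g \<otimes>\<^bsub>G\<^esub> h) ` (supp u \<times> supp v)"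
    then have "(u \<otimes>\<^bsub>S\<^esub> v) x = \<zero>\<^bsub>R\<^esub>"
      by (intro tgr_mult_eq_zero) auto
    then show False using x unfolding tgr_supp_def by blast
  qed
  show "finite ((\<lambda>(g, h). g \<otimes>\<^bsub>G\<^esub> h) ` (supp u \<times> supp v))"
    using u v by simp
qed

lemma tgr_r_distr:
  assumes u: "u \<in> carrier S" and v: "v \<in> carrier S" and w: "w \<in> carrier S"
  shows "u \<otimes>\<^bsub>S\<^esub> (v \<oplus>\<^bsub>S\<^esub> w) = u \<otimes>\<^bsub>S\<^esub> v \<oplus>\<^bsub>S\<^esub> u \<otimes>\<^bsub>S\<^esub> w"
proof
  fix x
  show "(u \<otimes>\<^bsub>S\<^esub> (v \<oplus>\<^bsub>S\<^esub> w)) x = (u \<otimes>\<^bsub>S\<^esub> v \<oplus>\<^bsub>S\<^esub> u \<otimes>\<^bsub>S\<^esub> w) x"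
  proof (cases "x \<in> carrier G")
    case True
    have g: "g \<in> carrier G" if "g \<in> supp u" for g using that by (simp add: tgr_supp_def)
    let ?t = "\<lambda>v g. \<alpha> g (inv\<^bsub>G\<^esub> g \<otimes>\<^bsub>G\<^esub> x) \<odot>\<^bsub>R\<^esub> (u g \<otimes>\<^bsub>R\<^esub> v (inv\<^bsub>G\<^esub> g \<otimes>\<^bsub>G\<^esub> x))"
    have "(u \<otimes>\<^bsub>S\<^esub> (v \<oplus>\<^bsub>S\<^esub> w)) x = finsum R (?t (v \<oplus>\<^bsub>S\<^esub> w)) (supp u)"
      using u v w True by (simp add: tgr_mult_left_sum[of _ _ _ "supp u"] supp_subset tgr_add_closed)
    also have "\<dots> = finsum R (\<lambda>g. ?t v g \<oplus>\<^bsub>R\<^esub> ?t w g) (supp u)"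
      by (rule M.finsum_cong')
         (use u v w True g in \<open>auto simp: tgr_add A.r_distr smult_r_distr\<close>)
    also have "\<dots> = finsum R (?t v) (supp u) \<oplus>\<^bsub>R\<^esub> finsum R (?t w) (supp u)"
      by (rule M.finsum_addf) (use u v w True g in auto)
    finally show ?thesis
      using u v w True by (simp add: tgr_mult_left_sum[of _ _ _ "supp u"] supp_subset tgr_add)
  qed (use u v w in \<open>simp add: tgr_add tgr_mult_outside\<close>)
qed

lemma tgr_l_distr:
  assumes u: "u \<in> carrier S" and v: "v \<in> carrier S" and w: "w \<in> carrier S"
  shows "(u \<oplus>\<^bsub>S\<^esub> v) \<otimes>\<^bsub>S\<^esub> w = u \<otimes>\<^bsub>S\<^esub> w \<oplus>\<^bsub>S\<^esub> v \<otimes>\<^bsub>S\<^esub> w"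
proof
  fix x
  show "((u \<oplus>\<^bsub>S\<^esub> v) \<otimes>\<^bsub>S\<^esub> w) x = (u \<otimes>\<^bsub>S\<^esub> w \<oplus>\<^bsub>S\<^esub> v \<otimes>\<^bsub>S\<^esub> w) x"
  proof (cases "x \<in> carrier G")
    case True
    let ?F = "supp u \<union> supp v"
    have F: "finite ?F" "?F \<subseteq> carrier G" "supp (u \<oplus>\<^bsub>S\<^esub> v) \<subseteq> ?F" "supp u \<subseteq> ?F" "supp v \<subseteq> ?F"
      using u v by (auto simp: supp_subset[THEN subsetD]) (auto simp: tgr_add tgr_supp_def)
    have g: "g \<in> carrier G" if "g \<in> ?F" for g using that F by auto
    let ?t = "\<lambda>u g. \<alpha> g (inv\<^bsub>G\<^esub> g \<otimes>\<^bsub>G\<^esub> x) \<odot>\<^bsub>R\<^esub> (u g \<otimes>\<^bsub>R\<^esub> w (inv\<^bsub>G\<^esub> g \<otimes>\<^bsub>G\<^esub> x))"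
    have "((u \<oplus>\<^bsub>S\<^esub> v) \<otimes>\<^bsub>S\<^esub> w) x = finsum R (?t (u \<oplus>\<^bsub>S\<^esub> v)) ?F"
      using u v w True F by (intro tgr_mult_left_sum) (auto simp: tgr_add_closed)
    also have "\<dots> = finsum R (\<lambda>g. ?t u g \<oplus>\<^bsub>R\<^esub> ?t v g) ?F"
      by (rule M.finsum_cong')
         (use u v w True g in \<open>auto simp: tgr_add A.l_distr smult_r_distr\<close>)
    also have "\<dots> = finsum R (?t u) ?F \<oplus>\<^bsub>R\<^esub> finsum R (?t v) ?F"
      by (rule M.finsum_addf) (use u v w True g in auto)
    also have "finsum R (?t u) ?F = (u \<otimes>\<^bsub>S\<^esub> w) x"
      using u v w True F by (intro tgr_mult_left_sum[symmetric]) auto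
    also have "finsum R (?t v) ?F = (v \<otimes>\<^bsub>S\<^esub> w) x"
      using u v w True F by (intro tgr_mult_left_sum[symmetric]) auto
    finally show ?thesis by (simp add: tgr_add)
  qed (use u v w in \<open>simp add: tgr_add tgr_mult_outside\<close>)
qed

text \<open>Every element is a finite sum of monomials, so additive identities, among them
  associativity and centrality, need to be checked on monomials only.\<close>

lemma tgr_induct [consumes 1, case_names monom add]:
  assumes u: "u \<in> carrier S"
    and monom: "\<And>a g. \<lbrakk>a \<in> carrier R; g \<in> carrier G\<rbrakk> \<Longrightarrow> P (monom a g)"
    and add: "\<And>u v. \<lbrakk>u \<in> carrier S; v \<in> carrier S; P u; P v\<rbrakk> \<Longrightarrow> P (u \<oplus>\<^bsub>S\<^esub> v)"
  shows "P u"
proof -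
  have "u \<in> carrier S \<Longrightarrow> supp u \<subseteq> F \<Longrightarrow> P u" if "finite F" for F
    using that
  proof (induction F arbitrary: u rule: finite_induct)
    case empty
    then have "u = monom \<zero>\<^bsub>R\<^esub> \<one>\<^bsub>G\<^esub>"
      using tgr_coeff_outside[OF empty(1)] by (auto simp: tgr_monom_def tgr_supp_def fun_eq_iff)
    then show ?case using monom[of "\<zero>\<^bsub>R\<^esub>" "\<one>\<^bsub>G\<^esub>"] by simp
  next
    case (insert g F)
    show ?case
    proof (cases "g \<in> carrier G")
      case False
      then have "supp u \<subseteq> F" using insert.prems by (auto simp: tgr_supp_def)
      then show ?thesis using insert by blast
    next
      case True
      let ?v = "u(g := \<zero>\<^bsub>R\<^esub>)"
      have sub: "supp ?v \<subseteq> F" using insert.prems by (auto simp: tgr_supp_def)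
      then have v: "?v \<in> carrier S"
        by (rule tgr_carrierI[rotated 2])
           (use insert.hyps tgr_coeff_outside[OF insert.prems(1)] insert.prems(1) in auto)
      have "u = monom (u g) g \<oplus>\<^bsub>S\<^esub> ?v"
        using insert.prems by (auto simp: tgr_add tgr_monom_def fun_eq_iff)
      moreover have "P (monom (u g) g \<oplus>\<^bsub>S\<^esub> ?v)"
        using insert True v sub monom by (intro add) auto
      ultimately show ?thesis by metis
    qed
  qed
  from this[OF tgr_finite_supp[OF u] u] show ?thesis by simp
qed

lemmas tgr_monom_mult = tgr_monom_mult[OF G.group_axioms two_cocycle]

text \<open>This is where the \<open>2\<close>-cocycle condition is needed.\<close>

lemma monom_assoc:
  assumes "a \<in> carrier R" "b \<in> carrier R" "c \<in> carrier R"
    and "g \<in> carrier G" "h \<in> carrier G" "k \<in> carrier G"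
  shows "(monom a g \<otimes>\<^bsub>S\<^esub> monom b h) \<otimes>\<^bsub>S\<^esub> monom c k = monom a g \<otimes>\<^bsub>S\<^esub> (monom b h \<otimes>\<^bsub>S\<^esub> monom c k)"
proof -
  have "\<alpha> (g \<otimes>\<^bsub>G\<^esub> h) k \<odot>\<^bsub>R\<^esub> ((\<alpha> g h \<odot>\<^bsub>R\<^esub> (a \<otimes>\<^bsub>R\<^esub> b)) \<otimes>\<^bsub>R\<^esub> c)
      = (\<alpha> g h \<otimes>\<^bsub>K\<^esub> \<alpha> (g \<otimes>\<^bsub>G\<^esub> h) k) \<odot>\<^bsub>R\<^esub> (a \<otimes>\<^bsub>R\<^esub> b \<otimes>\<^bsub>R\<^esub> c)"
    using assms by (simp add: smult_mult_left smult_assoc1[symmetric] R.m_comm)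
  also have "\<dots> = (\<alpha> h k \<otimes>\<^bsub>K\<^esub> \<alpha> g (h \<otimes>\<^bsub>G\<^esub> k)) \<odot>\<^bsub>R\<^esub> (a \<otimes>\<^bsub>R\<^esub> b \<otimes>\<^bsub>R\<^esub> c)"
    using assms by (simp add: cocycle_eq)
  also have "\<dots> = \<alpha> g (h \<otimes>\<^bsub>G\<^esub> k) \<odot>\<^bsub>R\<^esub> (a \<otimes>\<^bsub>R\<^esub> (\<alpha> h k \<odot>\<^bsub>R\<^esub> (b \<otimes>\<^bsub>R\<^esub> c)))"
    using assms by (simp add: smult_mult_right smult_assoc1[symmetric] R.m_comm A.m_assoc)
  finally show ?thesis
    using assms by (simp add: tgr_monom_mult G.m_assoc)
qed

lemma tgr_assoc:
  assumes "u \<in> carrier S" "v \<in> carrier S" "w \<in> carrier S"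
  shows "(u \<otimes>\<^bsub>S\<^esub> v) \<otimes>\<^bsub>S\<^esub> w = u \<otimes>\<^bsub>S\<^esub> (v \<otimes>\<^bsub>S\<^esub> w)"
  using assms(1)
proof (induction rule: tgr_induct)
  case (monom a g)
  note ag = this
  show ?case
    using assms(2)
  proof (induction rule: tgr_induct)
    case (monom b h)
    note bh = this
    show ?case
      using assms(3)
      by (induction rule: tgr_induct)
         (use ag bh in \<open>simp_all add: monom_assoc tgr_r_distr tgr_mult_closed tgr_add_closed\<close>)
  qed (use ag assms(3) in \<open>simp add: tgr_r_distr tgr_l_distr tgr_mult_closed\<close>)
qed (use assms in \<open>simp add: tgr_l_distr tgr_mult_closed\<close>)

theorem tgr_ring: "ring S"
proof (rule ringI)
  show "monoid S"
  proof (rule monoidI)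
    fix u assume u: "u \<in> carrier S"
    show "\<one>\<^bsub>S\<^esub> \<otimes>\<^bsub>S\<^esub> u = u"
      using u by (induction rule: tgr_induct)
        (simp_all add: tgr_one tgr_monom_mult tgr_r_distr)
    show "u \<otimes>\<^bsub>S\<^esub> \<one>\<^bsub>S\<^esub> = u"
      using u by (induction rule: tgr_induct)
        (simp_all add: tgr_one tgr_monom_mult tgr_l_distr)
  qed (simp_all add: tgr_mult_closed tgr_assoc tgr_one)
qed (simp_all add: tgr_abelian_group tgr_l_distr tgr_r_distr)

end

section \<open>The alpha-center\<close>

context twisted_group_algebra
begin

sublocale S: ring S by (rule tgr_ring)

lemma alpha_centerD:
  assumes "z \<in> alpha_center G \<alpha>"
  shows "z \<in> carrier G" and "\<And>x. x \<in> carrier G \<Longrightarrow> z \<otimes>\<^bsub>G\<^esub> x = x \<otimes>\<^bsub>G\<^esub> z"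
    and "\<And>x. x \<in> carrier G \<Longrightarrow> \<alpha> z x = \<alpha> x z"
  using assms by (auto simp: alpha_center_def group_center_def)

lemma alpha_centerI:
  assumes "z \<in> carrier G" "\<And>x. x \<in> carrier G \<Longrightarrow> z \<otimes>\<^bsub>G\<^esub> x = x \<otimes>\<^bsub>G\<^esub> z"
    and "\<And>x. x \<in> carrier G \<Longrightarrow> \<alpha> z x = \<alpha> x z"
  shows "z \<in> alpha_center G \<alpha>"
  using assms by (auto simp: alpha_center_def group_center_def)

text \<open>For commuting arguments, the cocycle identity at \<open>(a, b, x)\<close>, \<open>(a, x, b)\<close> and \<open>(x, a, b)\<close>
  carries \<open>\<alpha>(a b, x)\<close> over to \<open>\<alpha>(x, a b)\<close>, one factor being moved past \<open>x\<close> at a time.\<close>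

lemma alpha_center_mult:
  assumes a: "a \<in> alpha_center G \<alpha>" and b: "b \<in> alpha_center G \<alpha>"
  shows "a \<otimes>\<^bsub>G\<^esub> b \<in> alpha_center G \<alpha>"
proof (rule alpha_centerI)
  note A = alpha_centerD[OF a] and B = alpha_centerD[OF b]
  show "a \<otimes>\<^bsub>G\<^esub> b \<in> carrier G" using A(1) B(1) by simp
  fix x assume x: "x \<in> carrier G"
  show "a \<otimes>\<^bsub>G\<^esub> b \<otimes>\<^bsub>G\<^esub> x = x \<otimes>\<^bsub>G\<^esub> (a \<otimes>\<^bsub>G\<^esub> b)"
    using A(1) B(1) x by (simp add: G.m_assoc B(2)[OF x]) (simp add: G.m_assoc[symmetric] A(2)[OF x])
  have "\<alpha> a b \<otimes>\<^bsub>K\<^esub> \<alpha> (a \<otimes>\<^bsub>G\<^esub> b) x = \<alpha> b x \<otimes>\<^bsub>K\<^esub> \<alpha> a (b \<otimes>\<^bsub>G\<^esub> x)"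
    by (rule cocycle_eq[OF A(1) B(1) x])
  also have "\<dots> = \<alpha> x b \<otimes>\<^bsub>K\<^esub> \<alpha> a (x \<otimes>\<^bsub>G\<^esub> b)"
    by (simp only: B(2,3)[OF x])
  also have "\<dots> = \<alpha> a x \<otimes>\<^bsub>K\<^esub> \<alpha> (a \<otimes>\<^bsub>G\<^esub> x) b"
    by (rule cocycle_eq[OF A(1) x B(1), symmetric])
  also have "\<dots> = \<alpha> x a \<otimes>\<^bsub>K\<^esub> \<alpha> (x \<otimes>\<^bsub>G\<^esub> a) b"
    by (simp only: A(2,3)[OF x])
  also have "\<dots> = \<alpha> a b \<otimes>\<^bsub>K\<^esub> \<alpha> x (a \<otimes>\<^bsub>G\<^esub> b)"
    by (rule cocycle_eq[OF x A(1) B(1)])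
  finally show "\<alpha> (a \<otimes>\<^bsub>G\<^esub> b) x = \<alpha> x (a \<otimes>\<^bsub>G\<^esub> b)"
    using A(1) B(1) x cocycle_Units by (simp add: R.Units_l_cancel)
qed

lemma alpha_center_inv:
  assumes z: "z \<in> alpha_center G \<alpha>"
  shows "inv\<^bsub>G\<^esub> z \<in> alpha_center G \<alpha>"
proof (rule alpha_centerI)
  note Z = alpha_centerD[OF z]
  let ?i = "inv\<^bsub>G\<^esub> z"
  show i: "?i \<in> carrier G" using Z(1) by simp
  fix w assume w: "w \<in> carrier G"
  show iw: "?i \<otimes>\<^bsub>G\<^esub> w = w \<otimes>\<^bsub>G\<^esub> ?i"
  proof -
    have "?i \<otimes>\<^bsub>G\<^esub> w = ?i \<otimes>\<^bsub>G\<^esub> (w \<otimes>\<^bsub>G\<^esub> z) \<otimes>\<^bsub>G\<^esub> ?i"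
      using Z(1) w by (simp add: G.m_assoc)
    also have "\<dots> = w \<otimes>\<^bsub>G\<^esub> ?i"
      unfolding Z(2)[OF w, symmetric] using Z(1) w by (simp add: G.m_assoc[symmetric])
    finally show ?thesis .
  qed
  \<comment> \<open>With \<open>w = z x\<close>, both \<open>\<alpha>(inv z, w)\<close> and \<open>\<alpha>(w, inv z)\<close> come out of the cocycle identity
    as \<open>\<alpha>(z, inv z)\<close> divided by \<open>\<alpha>(z, x)\<close>.\<close>
  define x where "x = ?i \<otimes>\<^bsub>G\<^esub> w"
  have x: "x \<in> carrier G" and zx: "z \<otimes>\<^bsub>G\<^esub> x = w" "x \<otimes>\<^bsub>G\<^esub> z = w"
  proof -
    show "x \<in> carrier G" using Z(1) w by (simp add: x_def)
    show "z \<otimes>\<^bsub>G\<^esub> x = w" using Z(1) w by (simp add: x_def G.m_assoc[symmetric])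
    show "x \<otimes>\<^bsub>G\<^esub> z = w" unfolding x_def iw using Z(1) w by (simp add: G.m_assoc)
  qed
  have "\<alpha> z x \<otimes>\<^bsub>K\<^esub> \<alpha> ?i w = \<alpha> ?i z"
    using cocycle_eq[OF i Z(1) x] Z(1) x by (simp add: zx)
  also have "\<dots> = \<alpha> z ?i" using Z(3)[OF i] by simp
  also have "\<dots> = \<alpha> x z \<otimes>\<^bsub>K\<^esub> \<alpha> w ?i"
    using cocycle_eq[OF x Z(1) i] Z(1) x by (simp add: zx)
  also have "\<dots> = \<alpha> z x \<otimes>\<^bsub>K\<^esub> \<alpha> w ?i" using Z(3)[OF x] by simp
  finally show "\<alpha> ?i w = \<alpha> w ?i"
    using Z(1) x w cocycle_Units by (simp add: R.Units_l_cancel)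
qed

lemma alpha_center_normal: "alpha_center G \<alpha> \<lhd> G"
proof (rule G.normalI)
  show "subgroup (alpha_center G \<alpha>) G"
  proof
    show "alpha_center G \<alpha> \<subseteq> carrier G" by (auto dest: alpha_centerD)
    show "\<one>\<^bsub>G\<^esub> \<in> alpha_center G \<alpha>" by (rule alpha_centerI) simp_all
  qed (simp_all add: alpha_center_mult alpha_center_inv)
  show "\<forall>x\<in>carrier G. alpha_center G \<alpha> #>\<^bsub>G\<^esub> x = x <#\<^bsub>G\<^esub> alpha_center G \<alpha>"
    by (auto simp: r_coset_def l_coset_def alpha_centerD(2))
qed

section \<open>Scalars and basis elements\<close>

abbreviation scalar where "scalar k \<equiv> monom (k \<odot>\<^bsub>R\<^esub> \<one>\<^bsub>R\<^esub>) \<one>\<^bsub>G\<^esub>"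
abbreviation basis where "basis g \<equiv> monom \<one>\<^bsub>R\<^esub> g"

lemma scalar_central:
  assumes k: "k \<in> carrier K" and x: "x \<in> carrier S"
  shows "scalar k \<otimes>\<^bsub>S\<^esub> x = x \<otimes>\<^bsub>S\<^esub> scalar k"
  using x
proof (induction rule: tgr_induct)
  case (monom a g)
  then show ?case
    using k by (simp add: tgr_monom_mult smult_mult_left smult_mult_right)
qed (use k in \<open>simp add: S.l_distr S.r_distr\<close>)

lemma scalar_mult:
  "\<lbrakk>k \<in> carrier K; l \<in> carrier K\<rbrakk> \<Longrightarrow> scalar k \<otimes>\<^bsub>S\<^esub> scalar l = scalar (k \<otimes>\<^bsub>K\<^esub> l)"
  by (simp add: tgr_monom_mult smult_mult_left smult_assoc1)

lemma scalar_Units: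
  assumes "k \<in> Units K"
  shows "scalar k \<in> Units S"
proof -
  have "inv\<^bsub>K\<^esub> k \<in> carrier K" "k \<in> carrier K" using assms by auto
  moreover have "k \<otimes>\<^bsub>K\<^esub> inv\<^bsub>K\<^esub> k = \<one>\<^bsub>K\<^esub>" "inv\<^bsub>K\<^esub> k \<otimes>\<^bsub>K\<^esub> k = \<one>\<^bsub>K\<^esub>" using assms by auto
  ultimately show ?thesis
    unfolding Units_def
    by (auto simp: scalar_mult tgr_one intro!: bexI[of _ "scalar (inv\<^bsub>K\<^esub> k)"])
qed

lemma scalar_add_pow: "[(n::nat)] \<cdot>\<^bsub>S\<^esub> \<one>\<^bsub>S\<^esub> = scalar ([n] \<cdot>\<^bsub>K\<^esub> \<one>\<^bsub>K\<^esub>)"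
proof (induction n)
  case 0
  then show ?case by (simp add: tgr_zero tgr_monom_def)
next
  case (Suc n)
  have "scalar k \<oplus>\<^bsub>S\<^esub> scalar l = scalar (k \<oplus>\<^bsub>K\<^esub> l)"
    if "k \<in> carrier K" "l \<in> carrier K" for k l
    using that by (auto simp: tgr_add tgr_monom_def smult_l_distr fun_eq_iff)
  from this[of "[n] \<cdot>\<^bsub>K\<^esub> \<one>\<^bsub>K\<^esub>" "\<one>\<^bsub>K\<^esub>"] show ?case
    using Suc by (simp add: R.add.nat_pow_Suc S.add.nat_pow_Suc tgr_one)
qed

lemma basis_mult:
  "\<lbrakk>g \<in> carrier G; h \<in> carrier G\<rbrakk> \<Longrightarrow>
    basis g \<otimes>\<^bsub>S\<^esub> basis h = scalar (\<alpha> g h) \<otimes>\<^bsub>S\<^esub> basis (g \<otimes>\<^bsub>G\<^esub> h)"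
  by (simp add: tgr_monom_mult)

lemma coeff_mult_basis:
  "\<lbrakk>r \<in> carrier R; g \<in> carrier G\<rbrakk> \<Longrightarrow> monom r \<one>\<^bsub>G\<^esub> \<otimes>\<^bsub>S\<^esub> basis g = monom r g"
  "\<lbrakk>r \<in> carrier R; g \<in> carrier G\<rbrakk> \<Longrightarrow> basis g \<otimes>\<^bsub>S\<^esub> monom r \<one>\<^bsub>G\<^esub> = monom r g"
  by (simp_all add: tgr_monom_mult)

text \<open>Both products of the basis elements at \<open>g\<close> and at its inverse are invertible scalars.\<close>

lemma basis_Units:
  assumes g: "g \<in> carrier G"
  shows "basis g \<in> Units S"
proof -
  let ?h = "inv\<^bsub>G\<^esub> g"
  have h: "?h \<in> carrier G" using g by simp
  have gh: "basis g \<otimes>\<^bsub>S\<^esub> basis ?h = scalar (\<alpha> g ?h)"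
    and hg: "basis ?h \<otimes>\<^bsub>S\<^esub> basis g = scalar (\<alpha> ?h g)"
    using g by (simp_all add: tgr_monom_mult)
  have "scalar (\<alpha> g ?h) \<in> Units S" "scalar (\<alpha> ?h g) \<in> Units S"
    using g by (simp_all add: scalar_Units cocycle_Units)
  then obtain c c' where c: "c \<in> carrier S" "scalar (\<alpha> g ?h) \<otimes>\<^bsub>S\<^esub> c = \<one>\<^bsub>S\<^esub>"
    and c': "c' \<in> carrier S" "c' \<otimes>\<^bsub>S\<^esub> scalar (\<alpha> ?h g) = \<one>\<^bsub>S\<^esub>"
    unfolding Units_def by blast
  let ?r = "basis ?h \<otimes>\<^bsub>S\<^esub> c" and ?l = "c' \<otimes>\<^bsub>S\<^esub> basis ?h"
  have r: "basis g \<otimes>\<^bsub>S\<^esub> ?r = \<one>\<^bsub>S\<^esub>"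
    using S.m_assoc[of "basis g" "basis ?h" c] g c gh by simp
  have l: "?l \<otimes>\<^bsub>S\<^esub> basis g = \<one>\<^bsub>S\<^esub>"
    using S.m_assoc[of c' "basis ?h" "basis g"] g c' hg by simp
  have car: "?l \<in> carrier S" "?r \<in> carrier S" "basis g \<in> carrier S" using c c' g by simp_all
  then have "?l = ?r" using S.inv_unique[OF l r] by blast
  then show ?thesis using l r car unfolding Units_def by auto
qed

lemma basis_pow:
  assumes g: "g \<in> carrier G"
  shows "\<exists>k\<in>carrier K. basis g [^]\<^bsub>S\<^esub> (n::nat) = scalar k \<otimes>\<^bsub>S\<^esub> basis (g [^]\<^bsub>G\<^esub> n)"
proof (induction n)
  case 0
  have "\<one>\<^bsub>S\<^esub> = scalar \<one>\<^bsub>K\<^esub> \<otimes>\<^bsub>S\<^esub> basis (g [^]\<^bsub>G\<^esub> (0::nat))"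
    using S.r_one[OF S.one_closed] by (simp add: tgr_one)
  then show ?case by (intro bexI[of _ "\<one>\<^bsub>K\<^esub>"]) simp_all
next
  case (Suc n)
  then obtain k where k: "k \<in> carrier K"
    and eq: "basis g [^]\<^bsub>S\<^esub> n = scalar k \<otimes>\<^bsub>S\<^esub> basis (g [^]\<^bsub>G\<^esub> n)" by blast
  let ?l = "\<alpha> (g [^]\<^bsub>G\<^esub> n) g"
  have l: "?l \<in> carrier K" using g by simp
  have "basis g [^]\<^bsub>S\<^esub> Suc n = scalar k \<otimes>\<^bsub>S\<^esub> (basis (g [^]\<^bsub>G\<^esub> n) \<otimes>\<^bsub>S\<^esub> basis g)"
    using g k eq by (simp add: S.m_assoc)
  also have "\<dots> = scalar k \<otimes>\<^bsub>S\<^esub> (scalar ?l \<otimes>\<^bsub>S\<^esub> basis (g [^]\<^bsub>G\<^esub> Suc n))"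
    using g by (simp add: basis_mult)
  also have "\<dots> = scalar (k \<otimes>\<^bsub>K\<^esub> ?l) \<otimes>\<^bsub>S\<^esub> basis (g [^]\<^bsub>G\<^esub> Suc n)"
    using g k l by (simp add: S.m_assoc[symmetric] scalar_mult del: G.nat_pow_Suc)
  finally show ?case using k l by blast
qed

text \<open>The defining conditions of the \<open>\<alpha>\<close>-center say exactly that this basis element commutes
  with all monomials.\<close>

lemma basis_alpha_center_central:
  assumes z: "z \<in> alpha_center G \<alpha>" and x: "x \<in> carrier S"
  shows "basis z \<otimes>\<^bsub>S\<^esub> x = x \<otimes>\<^bsub>S\<^esub> basis z"
  using x
proof (induction rule: tgr_induct)
  case (monom a g)
  then show ?case
    using alpha_centerD[OF z] by (simp add: tgr_monom_mult)
qed (use alpha_centerD(1)[OF z] in \<open>simp add: S.l_distr S.r_distr\<close>)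

section \<open>Relative derivations are inner\<close>

text \<open>The hypotheses on the numbers are stated in \<open>K\<close>, where nonzero means invertible; scalars
  then turn them into units of the twisted group ring.\<close>

theorem relative_derivation_inner:
  assumes K: "field K"
    and fin: "finite (rcosets\<^bsub>G\<^esub> (alpha_center G \<alpha>))"
    and index: "[card (rcosets\<^bsub>G\<^esub> (alpha_center G \<alpha>))] \<cdot>\<^bsub>K\<^esub> \<one>\<^bsub>K\<^esub> \<noteq> \<zero>\<^bsub>K\<^esub>"
    and ord: "\<And>g. g \<in> carrier G \<Longrightarrow> [G.ord g] \<cdot>\<^bsub>K\<^esub> \<one>\<^bsub>K\<^esub> \<noteq> \<zero>\<^bsub>K\<^esub>"
    and d: "relative_derivation S (tgr_coeffs R G) d"
  shows "inner_derivation S d"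
proof -
  interpret K: field K by fact
  have der: "derivation S d" and const: "\<And>r. r \<in> carrier R \<Longrightarrow> d (monom r \<one>\<^bsub>G\<^esub>) = \<zero>\<^bsub>S\<^esub>"
    using d by (auto simp: relative_derivation_def tgr_coeffs_def)
  have scalar_d: "d (scalar k) = \<zero>\<^bsub>S\<^esub>" if "k \<in> carrier K" for k
    using that by (simp add: const)
  have unit: "[n] \<cdot>\<^bsub>S\<^esub> \<one>\<^bsub>S\<^esub> \<in> Units S" if "[n] \<cdot>\<^bsub>K\<^esub> \<one>\<^bsub>K\<^esub> \<noteq> \<zero>\<^bsub>K\<^esub>" for n :: nat
    unfolding scalar_add_pow using that by (intro scalar_Units) (simp add: K.field_Units)
  have center: "d (basis z) = \<zero>\<^bsub>S\<^esub>" if z: "z \<in> alpha_center G \<alpha>" for z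
  proof (rule S.derivation_zero_if_pow_constant[OF der])
    have zG: "z \<in> carrier G" using alpha_centerD(1)[OF z] .
    show "basis z \<in> Units S" using zG by (rule basis_Units)
    show "[G.ord z] \<cdot>\<^bsub>S\<^esub> \<one>\<^bsub>S\<^esub> \<in> Units S" by (intro unit ord zG)
    show "basis z \<otimes>\<^bsub>S\<^esub> d (basis z) = d (basis z) \<otimes>\<^bsub>S\<^esub> basis z"
      using S.derivation_closed[OF der] zG by (intro basis_alpha_center_central[OF z]) simp
    obtain k where k: "k \<in> carrier K"
      and "basis z [^]\<^bsub>S\<^esub> G.ord z = scalar k \<otimes>\<^bsub>S\<^esub> basis (z [^]\<^bsub>G\<^esub> G.ord z)"
      using basis_pow[OF zG] by blast
    then have "basis z [^]\<^bsub>S\<^esub> G.ord z = scalar k"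
      using zG by (simp add: coeff_mult_basis)
    then show "d (basis z [^]\<^bsub>S\<^esub> G.ord z) = \<zero>\<^bsub>S\<^esub>" using k by (simp add: scalar_d)
  qed
  obtain a where a: "a \<in> carrier S"
    and ag: "\<And>g. g \<in> carrier G \<Longrightarrow> d (basis g) = a \<otimes>\<^bsub>S\<^esub> basis g \<ominus>\<^bsub>S\<^esub> basis g \<otimes>\<^bsub>S\<^esub> a"
    and aR: "\<And>x. \<lbrakk>x \<in> carrier S; d x = \<zero>\<^bsub>S\<^esub>;
        \<And>g. g \<in> carrier G \<Longrightarrow> x \<otimes>\<^bsub>S\<^esub> basis g = basis g \<otimes>\<^bsub>S\<^esub> x\<rbrakk> \<Longrightarrow> x \<otimes>\<^bsub>S\<^esub> a = a \<otimes>\<^bsub>S\<^esub> x"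
  proof (rule S.derivation_inner_on_projective_representation
      [OF der alpha_center_normal fin unit[OF index], of "\<lambda>g. basis g"])
    fix g h assume gh: "g \<in> carrier G" "h \<in> carrier G"
    show "\<exists>c\<in>Units S. d c = \<zero>\<^bsub>S\<^esub> \<and> (\<forall>x\<in>carrier S. c \<otimes>\<^bsub>S\<^esub> x = x \<otimes>\<^bsub>S\<^esub> c) \<and>
        basis g \<otimes>\<^bsub>S\<^esub> basis h = c \<otimes>\<^bsub>S\<^esub> basis (g \<otimes>\<^bsub>G\<^esub> h)"
      using gh by (intro bexI[of _ "scalar (\<alpha> g h)"] conjI ballI)
        (simp_all add: scalar_d scalar_central basis_mult scalar_Units cocycle_Units)
  qed (use basis_Units center in blast)+
  have "d x = a \<otimes>\<^bsub>S\<^esub> x \<ominus>\<^bsub>S\<^esub> x \<otimes>\<^bsub>S\<^esub> a" if "x \<in> carrier S" for x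
    using that
  proof (induction rule: tgr_induct)
    case (monom r g)
    let ?r = "monom r \<one>\<^bsub>G\<^esub>"
    have rc: "?r \<in> carrier S" "basis g \<in> carrier S" using monom by simp_all
    have ra: "?r \<otimes>\<^bsub>S\<^esub> a = a \<otimes>\<^bsub>S\<^esub> ?r"
      by (rule aR) (use monom in \<open>simp_all add: const coeff_mult_basis\<close>)
    have "d (?r \<otimes>\<^bsub>S\<^esub> basis g) = ?r \<otimes>\<^bsub>S\<^esub> (a \<otimes>\<^bsub>S\<^esub> basis g \<ominus>\<^bsub>S\<^esub> basis g \<otimes>\<^bsub>S\<^esub> a)"
      using S.derivation_mult[OF der rc] monom a rc by (simp add: const ag)
    also have "\<dots> = (?r \<otimes>\<^bsub>S\<^esub> a) \<otimes>\<^bsub>S\<^esub> basis g \<ominus>\<^bsub>S\<^esub> (?r \<otimes>\<^bsub>S\<^esub> basis g) \<otimes>\<^bsub>S\<^esub> a"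
      using a rc by (simp add: S.minus_eq S.r_distr S.r_minus S.m_assoc)
    also have "\<dots> = a \<otimes>\<^bsub>S\<^esub> (?r \<otimes>\<^bsub>S\<^esub> basis g) \<ominus>\<^bsub>S\<^esub> (?r \<otimes>\<^bsub>S\<^esub> basis g) \<otimes>\<^bsub>S\<^esub> a"
      unfolding ra using a rc by (simp add: S.m_assoc)
    finally show ?case using monom by (simp add: coeff_mult_basis)
  next
    case (add u v)
    have "d (u \<oplus>\<^bsub>S\<^esub> v) = (a \<otimes>\<^bsub>S\<^esub> u \<ominus>\<^bsub>S\<^esub> u \<otimes>\<^bsub>S\<^esub> a) \<oplus>\<^bsub>S\<^esub> (a \<otimes>\<^bsub>S\<^esub> v \<ominus>\<^bsub>S\<^esub> v \<otimes>\<^bsub>S\<^esub> a)"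
      using der add by (simp add: derivation_def)
    then show ?case
      using a add(1,2) by (simp add: S.minus_eq S.l_distr S.r_distr S.minus_add S.a_ac)
  qed
  then show ?thesis using a by (auto simp: inner_derivation_def)
qed

lemma one_add_pow: "([(n::nat)] \<cdot>\<^bsub>K\<^esub> \<one>\<^bsub>K\<^esub>) \<odot>\<^bsub>R\<^esub> \<one>\<^bsub>R\<^esub> = [n] \<cdot>\<^bsub>R\<^esub> \<one>\<^bsub>R\<^esub>"
  by (induction n) (simp_all add: R.add.nat_pow_Suc M.add.nat_pow_Suc smult_l_distr)

end

theorem mainTheorem1:
  fixes K :: "('k, 'a) ring_scheme"
    and R :: "('k, 'r, 'b) module_scheme"
    and G :: "('g, 'c) monoid_scheme"
    and \<alpha> :: "'g \<Rightarrow> 'g \<Rightarrow> 'k"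
    and d :: "('g \<Rightarrow> 'r) \<Rightarrow> ('g \<Rightarrow> 'r)"
  assumes "field K"
    and "assoc_algebra K R"
    and "semiprime_ring R"
    and "torsion_group G"
    and "normalized_two_cocycle K G \<alpha>"
    and "finite (rcosets\<^bsub>G\<^esub> (alpha_center G \<alpha>))"
    and "ring_char R = 0 \<or>
         (\<forall>p. is_characteristic p R \<longrightarrow> (\<forall>g\<in>carrier G. \<not> p dvd group.ord G g))"
    and "relative_derivation (twisted_group_ring R G \<alpha>) (tgr_coeffs R G) d"
  shows "inner_derivation (twisted_group_ring R G \<alpha>) d"
proof -
  interpret K: field K by fact
  interpret assoc_algebra K R by fact
  interpret G: group G using assms(4) by (simp add: torsion_group_def)
  interpret twisted_group_algebra K R G \<alpha>
    by unfold_locales fact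
  show ?thesis
  \<comment> \<open>The zero ring has no characteristic at all, so there the assumption says nothing about
    \<open>K\<close>. It has to be split off.\<close>
  proof (cases "\<one>\<^bsub>R\<^esub> = \<zero>\<^bsub>R\<^esub>")
    case True
    have "u = \<zero>\<^bsub>S\<^esub>" if "u \<in> carrier S" for u
    proof
      fix g
      have "u g = \<one>\<^bsub>R\<^esub> \<otimes>\<^bsub>R\<^esub> u g" using that by simp
      then show "u g = \<zero>\<^bsub>S\<^esub> g" using True that by (simp add: tgr_zero)
    qed
    then have "d x = \<zero>\<^bsub>S\<^esub> \<otimes>\<^bsub>S\<^esub> x \<ominus>\<^bsub>S\<^esub> x \<otimes>\<^bsub>S\<^esub> \<zero>\<^bsub>S\<^esub>" if "x \<in> carrier S" for x
      using that assms(8) S.derivation_closed S.minus_closed S.m_closed S.zero_closed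
      unfolding relative_derivation_def by metis
    then show ?thesis unfolding inner_derivation_def using S.zero_closed by blast
  next
    case False
    \<comment> \<open>A prime that vanishes in \<open>K\<close> annihilates \<open>1\<close> in \<open>R\<close>; this makes it a characteristic of
      \<open>R\<close> and also excludes \<open>ring_char R = 0\<close>.\<close>
    have not_dvd: "\<not> p dvd G.ord g"
      if p: "Factorial_Ring.prime p" "[p] \<cdot>\<^bsub>K\<^esub> \<one>\<^bsub>K\<^esub> = \<zero>\<^bsub>K\<^esub>" and g: "g \<in> carrier G" for p g
    proof -
      have p0: "p > 0" using p(1) by (rule prime_gt_0_nat)
      have pR: "[p] \<cdot>\<^bsub>R\<^esub> \<one>\<^bsub>R\<^esub> = \<zero>\<^bsub>R\<^esub>"
        using one_add_pow[of p] p(2) by simp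
      have "is_characteristic p R"
        using p(1) pR False by (auto simp: is_characteristic_def)
      moreover have "ring_char R \<noteq> 0"
      proof -
        let ?P = "\<lambda>n::nat. n > 0 \<and> [n] \<cdot>\<^bsub>R\<^esub> \<one>\<^bsub>R\<^esub> = \<zero>\<^bsub>R\<^esub>"
        have "?P (LEAST n. ?P n)" by (rule LeastI[of ?P p]) (use p0 pR in simp)
        then show ?thesis using p0 pR by (auto simp: ring_char_def)
      qed
      ultimately show ?thesis using assms(7) g by metis
    qed
    have ord: "[G.ord g] \<cdot>\<^bsub>K\<^esub> \<one>\<^bsub>K\<^esub> \<noteq> \<zero>\<^bsub>K\<^esub>" if g: "g \<in> carrier G" for g
    proof
      have "G.ord g > 0"
        using assms(4) g G.pow_eq_id[OF g] unfolding torsion_group_def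
        by (metis dvd_0_left_iff gr_zeroI less_irrefl)
      moreover assume "[G.ord g] \<cdot>\<^bsub>K\<^esub> \<one>\<^bsub>K\<^esub> = \<zero>\<^bsub>K\<^esub>"
      ultimately show False using K.prime_annihilating_one not_dvd g by blast
    qed
    have index: "[card (rcosets\<^bsub>G\<^esub> (alpha_center G \<alpha>))] \<cdot>\<^bsub>K\<^esub> \<one>\<^bsub>K\<^esub> \<noteq> \<zero>\<^bsub>K\<^esub>"
    proof
      interpret N: normal "alpha_center G \<alpha>" G by (rule alpha_center_normal)
      have "alpha_center G \<alpha> \<in> rcosets\<^bsub>G\<^esub> (alpha_center G \<alpha>)"
        using N.subgroup_in_rcosets[OF G.group_axioms] .
      then have "card (rcosets\<^bsub>G\<^esub> (alpha_center G \<alpha>)) > 0"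
        using assms(6) card_gt_0_iff by blast
      moreover assume "[card (rcosets\<^bsub>G\<^esub> (alpha_center G \<alpha>))] \<cdot>\<^bsub>K\<^esub> \<one>\<^bsub>K\<^esub> = \<zero>\<^bsub>K\<^esub>"
      ultimately show False
        using K.prime_annihilating_one not_dvd
          G.prime_dvd_index_imp_dvd_ord[OF alpha_center_normal assms(6)] by blast
    qed
    show ?thesis
      by (rule relative_derivation_inner[OF assms(1,6) index ord assms(8)])
  qed
qed

end
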